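(* Let $q\ge8$ be even. The $\mathrm{Un}\Gamma$-lines (lines meeting the twisted cubic $\mathcal{C}$ in exactly one point and contained in no osculating plane) form one orbit under $G_q$, namely $\{\ell\varphi:\varphi\in G_q\}$ where $\ell$ is the line through $P_0=P(0,0,0,1)$ and $P(1,0,1,0)$. The subgroup of $G_q$ fixing any $\mathrm{Un}\Gamma$-line is trivial.
   Context: $\mathrm{PG}(3,q)$ has points $P(x_0,x_1,x_2,x_3)$; $\boldsymbol{\pi}(c_0,c_1,c_2,c_3)$ is the plane $c_0x_0+c_1x_1+c_2x_2+c_3x_3=0$. The twisted cubic is $\mathcal{C}=\{P(t^3,t^2,t,1):t\in\mathbb{F}_q\}\cup\{P(1,0,0,0)\}$; the osculating planes are $\boldsymbol{\pi}(1,-3t,3t^2,-t^3)$, $t\in\mathbb{F}_q$, and $\boldsymbol{\pi}(0,0,0,1)$. $G_q$ is the group of projectivities of $\mathrm{PG}(3,q)$ mapping $\mathcal{C}$ to itself. *)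

theory Defs
  imports "HOL-Analysis.Analysis"
begin

text \<open>Vectors of F_q^4 are indexed by the type 4 = {0,1,2,3}; component i is x_i.
  Projective points of PG(3,q) are 1-dimensional subspaces, lines 2-dimensional subspaces,
  both represented as sets of vectors. A projectivity is induced by an invertible 4x4 matrix.\<close>

definition vec4 :: "'a \<Rightarrow> 'a \<Rightarrow> 'a \<Rightarrow> 'a \<Rightarrow> 'a^4" where
  "vec4 a b c d = (\<chi> i. if i = 0 then a else if i = 1 then b else if i = 2 then c else d)"

definition pspan :: "'a::field^4 \<Rightarrow> ('a^4) set" where
  "pspan v = {c *s v | c. True}"

definition lspan :: "'a::field^4 \<Rightarrow> 'a^4 \<Rightarrow> ('a^4) set" where
  "lspan u v = {a *s u + b *s v | a b. True}"

definition is_line :: "('a::field^4) set \<Rightarrow> bool" where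
  "is_line L \<longleftrightarrow> (\<exists>u v. (\<forall>a b. a *s u + b *s v = 0 \<longrightarrow> a = 0 \<and> b = 0) \<and> L = lspan u v)"

definition plane :: "'a::field^4 \<Rightarrow> ('a^4) set" where
  "plane c = {x. (\<Sum>i\<in>UNIV. c $ i * x $ i) = 0}"

definition twisted_cubic :: "('a::field^4) set set" where
  "twisted_cubic = {pspan (vec4 (t^3) (t^2) t 1) | t. True} \<union> {pspan (vec4 1 0 0 0)}"

definition osc_coeffs :: "('a::field^4) set" where
  "osc_coeffs = {vec4 1 (-3*t) (3*t^2) (-(t^3)) | t. True} \<union> {vec4 0 0 0 1}"

definition proj_map :: "'a::field^4^4 \<Rightarrow> ('a^4) set \<Rightarrow> ('a^4) set" where
  "proj_map A S = (\<lambda>x. A *v x) ` S"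

definition Gq :: "('a::field^4^4) set" where
  "Gq = {A. invertible A \<and> (proj_map A) ` twisted_cubic = twisted_cubic}"

definition UnGamma_line :: "('a::field^4) set \<Rightarrow> bool" where
  "UnGamma_line L \<longleftrightarrow> is_line L \<and> card {P \<in> twisted_cubic. P \<subseteq> L} = 1
     \<and> (\<forall>c \<in> osc_coeffs. \<not> L \<subseteq> plane c)"

definition ell0 :: "('a::field^4) set" where
  "ell0 = lspan (vec4 0 0 0 1) (vec4 1 0 1 0)"

end

theory Submission
  imports Defs
begin

text \<open>With the parameter \<open>s = 1/t\<close>, the elements of \<open>G_q\<close> fixing \<open>P0\<close> are the maps induced by
  \<open>s \<mapsto> a s + b\<close>: a matrix fixing both \<open>P0\<close> and \<open>P(1,0,0,0)\<close> is diagonal with entries in geometric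
  progression, because the quadrics through the cubic become polynomial identities in \<open>s\<close>. Together
  with the coordinate reversal these maps generate \<open>G_q\<close>, which therefore permutes the osculating
  planes. An \<open>UnGamma\<close>-line can be moved to one through \<open>P0\<close>; those join \<open>P0\<close> to \<open>(1, b, c, 0)\<close>
  with \<open>c \<noteq> b^2\<close>. In characteristic 2 the map \<open>s \<mapsto> a s + b\<close> sends \<open>ell0\<close> to the line with
  \<open>c = a^2 + b^2\<close>, and bijectivity of the Frobenius map gives exactly one \<open>(a, b)\<close> for each line.\<close>

section \<open>Coordinates for vectors and matrices\<close>

lemma vec4_nth [simp]:
  "vec4 a b c d $ 0 = a" "vec4 a b c d $ 1 = b" "vec4 a b c d $ 2 = c" "vec4 a b c d $ 3 = d"
  by (simp_all add: vec4_def)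

lemma sum_UNIV_4: "sum f (UNIV :: 4 set) = f 0 + f 1 + f 2 + f 3"
proof -
  \<comment> \<open>\<open>sum_4\<close> enumerates the type as 1, 2, 3, 4; the index 4 is the index
    0.\<close>
  have "(4 :: 4) = 0" by simp
  then have "f 4 = f 0" by (rule arg_cong)
  then show ?thesis by (simp add: sum_4 add_ac)
qed

lemma vec4_cases: obtains a b c d where "x = vec4 a b c d"
proof
  have "(4 :: 4) = 0" by simp
  then have "x $ 4 = x $ 0" by (rule arg_cong)
  then show "x = vec4 (x $ 0) (x $ 1) (x $ 2) (x $ 3)"
    by (simp add: vec_eq_iff forall_4) (simp add: vec4_def)
qed

lemma vec4_eq_iff [simp]:
  "vec4 a b c d = vec4 a' b' c' d' \<longleftrightarrow> a = a' \<and> b = b' \<and> c = c' \<and> d = d'"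
  by (metis vec4_nth)

lemma vec4_smult [simp]: "k *s vec4 a b c d = vec4 (k * a) (k * b) (k * c) (k * d)"
  by (simp add: vec_eq_iff vec4_def)

lemma vec4_add [simp]:
  "vec4 a b c d + vec4 a' b' c' d' = vec4 (a + a') (b + b') (c + c') (d + d')"
  by (simp add: vec_eq_iff vec4_def)

lemma zero_vec4: "0 = vec4 0 0 0 0"
  by (simp add: vec_eq_iff vec4_def)

lemma vec4_eq_0_iff [simp]: "vec4 a b c d = 0 \<longleftrightarrow> a = 0 \<and> b = 0 \<and> c = 0 \<and> d = 0"
  by (simp add: zero_vec4)

lemma mem_plane_vec4 [simp]:
  "vec4 x y z w \<in> plane (vec4 a b c d) \<longleftrightarrow> a * x + b * y + c * z + d * w = 0"
  by (simp add: plane_def sum_UNIV_4)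

lemma matrix_vec4_mult [simp]:
  "vec4 r s t u *v vec4 a b c d = vec4
     (r $ 0 * a + r $ 1 * b + r $ 2 * c + r $ 3 * d)
     (s $ 0 * a + s $ 1 * b + s $ 2 * c + s $ 3 * d)
     (t $ 0 * a + t $ 1 * b + t $ 2 * c + t $ 3 * d)
     (u $ 0 * a + u $ 1 * b + u $ 2 * c + u $ 3 * d)"
  by (simp add: vec_eq_iff matrix_vector_mult_def sum_UNIV_4 vec4_def)

lemma matrix_eqI_vec4:
  fixes A B :: "'a::field^4^'n"
  assumes "\<And>a b c d. A *v vec4 a b c d = B *v vec4 a b c d"
  shows "A = B"
  unfolding matrix_eq by (metis assms vec4_cases)

lemma mat_vec4_mult: "mat k *v (x :: 'a::field^'n) = k *s x"
  by (simp add: vec_eq_iff matrix_vector_mult_def mat_def if_distrib[of "\<lambda>z. z * _"] cong: if_cong)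

lemma matrix_vector_smult: "A *v (k *s x) = k *s (A *v (x :: 'a::field^'n))"
  by (simp add: vector_scalar_commute)

lemma invertible_mult_cancel:
  fixes A :: "'a::field^'n^'n"
  assumes "invertible A"
  shows "A *v x = A *v y \<longleftrightarrow> x = y"
  by (metis assms invertible_def matrix_vector_mul_assoc matrix_vector_mul_lid)

section \<open>Points and lines\<close>

lemma pspan_mem: "v \<in> pspan v"
  unfolding pspan_def by (auto intro: exI[of _ 1])

lemma pspan_smult:
  assumes "k \<noteq> 0" shows "pspan (k *s v) = pspan v"
proof -
  have "c *s v = (c / k) *s (k *s v)" "c *s (k *s v) = (c * k) *s v" for c using assms by simp_all
  then show ?thesis unfolding pspan_def by blast
qed

lemma pspan_eqD:
  assumes "pspan v = pspan w" "v \<noteq> 0"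
  obtains k where "k \<noteq> 0" "v = k *s w"
proof -
  have "v \<in> pspan w" using assms pspan_mem by metis
  then obtain k where "v = k *s w" by (auto simp: pspan_def)
  moreover then have "k \<noteq> 0" using assms by auto
  ultimately show thesis using that by blast
qed

lemma proj_map_pspan: "proj_map A (pspan v) = pspan (A *v v)"
  unfolding proj_map_def pspan_def by (force simp: matrix_vector_smult)

lemma proj_map_lspan: "proj_map A (lspan u v) = lspan (A *v u) (A *v v)"
  unfolding proj_map_def lspan_def
  by (force simp: matrix_vector_smult matrix_vector_right_distrib)

lemma proj_map_mult: "proj_map (A ** B) S = proj_map A (proj_map B S)"
  by (simp add: proj_map_def image_image matrix_vector_mul_assoc)

lemma proj_map_mat_1: "proj_map (mat 1) S = S"
  by (simp add: proj_map_def)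

lemma proj_map_mono_iff:
  "invertible A \<Longrightarrow> proj_map A S \<subseteq> proj_map A T \<longleftrightarrow> S \<subseteq> T"
  unfolding proj_map_def by (simp add: inj_image_subset_iff inj_def invertible_mult_cancel)

lemma inj_proj_map: "invertible A \<Longrightarrow> inj (proj_map A)"
  by (rule injI) (metis proj_map_mono_iff subset_antisym order_refl)

lemma is_line_proj_map:
  assumes "invertible A" "is_line L" shows "is_line (proj_map A L)"
proof -
  obtain u v where uv: "\<forall>a b. a *s u + b *s v = 0 \<longrightarrow> a = 0 \<and> b = 0" "L = lspan u v"
    using assms by (auto simp: is_line_def)
  have "a = 0 \<and> b = 0" if "a *s (A *v u) + b *s (A *v v) = 0" for a b
  proof -
    have "A *v (a *s u + b *s v) = A *v 0"
      using that by (simp add: matrix_vector_smult matrix_vector_right_distrib)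
    then show ?thesis using uv(1) assms(1) by (simp only: invertible_mult_cancel)
  qed
  then show ?thesis unfolding is_line_def using uv(2) proj_map_lspan by metis
qed

lemma is_line_pspan_subset_iff:
  assumes "is_line L" shows "pspan v \<subseteq> L \<longleftrightarrow> v \<in> L"
proof
  assume "v \<in> L"
  obtain x y where L: "L = lspan x y" using assms by (auto simp: is_line_def)
  obtain a b where v: "v = a *s x + b *s y" using \<open>v \<in> L\<close> by (auto simp: L lspan_def)
  have "k *s v = (k * a) *s x + (k * b) *s y" for k
    by (simp add: v vector_add_ldistrib vector_smult_assoc)
  then show "pspan v \<subseteq> L" unfolding L pspan_def lspan_def by blast
qed (use pspan_mem in blast)

lemma is_line_lincomb:
  assumes "is_line L" "x \<in> L" "y \<in> L" shows "a *s x + b *s y \<in> L"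
proof -
  obtain u v where L: "L = lspan u v" using assms by (auto simp: is_line_def)
  obtain c d c' d' where *: "x = c *s u + d *s v" "y = c' *s u + d' *s v"
    using assms by (auto simp: L lspan_def)
  have "a *s x + b *s y = (a * c + b * c') *s u + (a * d + b * d') *s v"
    by (simp add: * vec_eq_iff algebra_simps)
  then show ?thesis unfolding L lspan_def by blast
qed

text \<open>Cramer's rule: independence makes the determinant \<open>D\<close> of the coordinates of
  \<open>x\<close>, \<open>y\<close> with respect to \<open>u\<close>, \<open>v\<close> nonzero, so
  \<open>u\<close> and \<open>v\<close> are combinations of \<open>x\<close> and
  \<open>y\<close>.\<close>

lemma is_line_eq_lspan:
  fixes L :: "('a::field^4) set"
  assumes L: "is_line L" and xy: "x \<in> L" "y \<in> L"
    and indep: "\<And>a b. a *s x + b *s y = 0 \<Longrightarrow> a = 0 \<and> b = 0"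
  shows "L = lspan x y"
proof
  obtain u v where Luv: "L = lspan u v" using L by (auto simp: is_line_def)
  obtain a b c d where *: "x = a *s u + b *s v" "y = c *s u + d *s v"
    using xy by (auto simp: Luv lspan_def)
  define D where "D = a * d - b * c"
  have Du: "D *s u = d *s x + (- b) *s y" and Dv: "D *s v = (- c) *s x + a *s y"
    by (simp_all add: * D_def vec_eq_iff algebra_simps)
  have "D \<noteq> 0"
  proof
    assume "D = 0"
    then have "d *s x + (- b) *s y = 0" "(- c) *s x + a *s y = 0" using Du Dv by auto
    then have "d = 0" "b = 0" "c = 0" "a = 0" using indep[of d "- b"] indep[of "- c" a] by simp_all
    then show False using indep[of 1 0] * by simp
  qed
  have "e *s u + f *s v = ((e * d - f * c) / D) *s x + ((f * a - e * b) / D) *s y" for e f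
  proof -
    have "e *s u + f *s v = (e / D) *s (D *s u) + (f / D) *s (D *s v)"
      using \<open>D \<noteq> 0\<close> by simp
    also have "\<dots> = ((e * d - f * c) / D) *s x + ((f * a - e * b) / D) *s y"
      unfolding Du Dv by (simp add: vec_eq_iff algebra_simps diff_divide_distrib)
    finally show ?thesis .
  qed
  then show "L \<subseteq> lspan x y" unfolding Luv lspan_def by blast
  show "lspan x y \<subseteq> L" unfolding lspan_def using is_line_lincomb[OF L xy] by blast
qed

section \<open>The group of the twisted cubic\<close>

definition cubic_vec :: "'a::field \<Rightarrow> 'a^4" where
  "cubic_vec s = vec4 1 s (s^2) (s^3)"

abbreviation P0 :: "('a::field^4) set" where
  "P0 \<equiv> pspan (vec4 0 0 0 1)"

text \<open>The parameter \<open>s\<close> is the inverse of the parameter \<open>t\<close> of the twisted cubic, so that \<open>P0\<close>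
  is the point at infinity and its stabiliser acts by affine maps of \<open>s\<close>.\<close>

lemma twisted_cubic_eq: "twisted_cubic = insert P0 (range (\<lambda>s. pspan (cubic_vec s)))"
proof -
  \<comment> \<open>The scalar \<open>t^3\<close> matches the two parametrisations when
    \<open>t\<close> is nonzero. The exceptional points trade roles: \<open>t = 0\<close> is
    \<open>P0\<close>, and P(1,0,0,0) is \<open>s = 0\<close>.\<close>
  have *: "pspan (vec4 (t^3) (t^2) t 1) = pspan (cubic_vec (1 / t))" if "t \<noteq> 0" for t :: 'a
    using pspan_smult[of "t^3" "cubic_vec (1 / t)"] that
    by (simp add: cubic_vec_def field_simps power2_eq_square power3_eq_cube)
  have **: "pspan (cubic_vec s) = pspan (vec4 ((1/s)^3) ((1/s)^2) (1/s) 1)" if "s \<noteq> 0" for s :: 'a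
    using *[of "1 / s"] that by simp
  show ?thesis
  proof (intro equalityI subsetI)
    fix P :: "('a^4) set" assume "P \<in> twisted_cubic"
    then consider t where "P = pspan (vec4 (t^3) (t^2) t 1)" | "P = pspan (vec4 1 0 0 0)"
      by (auto simp: twisted_cubic_def)
    then show "P \<in> insert P0 (range (\<lambda>s. pspan (cubic_vec s)))"
    proof cases
      case (1 t)
      then show ?thesis using *[of t] by (cases "t = 0") auto
    next
      case 2
      then have "P = pspan (cubic_vec 0)" by (simp add: cubic_vec_def)
      then show ?thesis by blast
    qed
  next
    fix P :: "('a^4) set" assume "P \<in> insert P0 (range (\<lambda>s. pspan (cubic_vec s)))"
    then consider "P = P0" | s where "P = pspan (cubic_vec s)" by auto
    then show "P \<in> twisted_cubic"
    proof cases
      case 1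
      then have "P = pspan (vec4 (0^3) (0^2) 0 1)" by simp
      then show ?thesis unfolding twisted_cubic_def by blast
    next
      case (2 s)
      then show ?thesis using **[of s]
        by (cases "s = 0") (auto simp: twisted_cubic_def cubic_vec_def)
    qed
  qed
qed

lemma pspan_cubic_vec_neq_P0: "pspan (cubic_vec s) \<noteq> P0"
proof
  assume "pspan (cubic_vec s) = P0"
  from pspan_eqD[OF this] show False by (auto simp: cubic_vec_def)
qed

text \<open>Induces \<open>s\<close> to \<open>1 / s\<close> on the cubic, exchanging
  \<open>P0\<close> with the point \<open>s = 0\<close>.\<close>

definition rev_mat :: "'a::field^4^4" where
  "rev_mat = vec4 (vec4 0 0 0 1) (vec4 0 0 1 0) (vec4 0 1 0 0) (vec4 1 0 0 0)"

text \<open>This matrix induces \<open>s \<mapsto> a s + b\<close> on the cubic; the factor \<open>k\<close> makes the family closed under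
  scalar multiples.\<close>

definition aff_mat :: "'a::field \<Rightarrow> 'a \<Rightarrow> 'a \<Rightarrow> 'a^4^4" where
  "aff_mat k a b = vec4 (vec4 k 0 0 0) (vec4 (k * b) (k * a) 0 0)
     (vec4 (k * b^2) (2 * k * a * b) (k * a^2) 0)
     (vec4 (k * b^3) (3 * k * a * b^2) (3 * k * a^2 * b) (k * a^3))"

lemma rev_mat_mult_self: "rev_mat ** rev_mat = mat 1"
  by (rule matrix_eqI_vec4) (simp add: rev_mat_def flip: matrix_vector_mul_assoc)

lemma aff_mat_mult: "aff_mat k a b ** aff_mat k' a' b' = aff_mat (k * k') (a * a') (a * b' + b)"
  by (rule matrix_eqI_vec4)
    (simp add: aff_mat_def algebra_simps power2_eq_square power3_eq_cube flip: matrix_vector_mul_assoc)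

lemma aff_mat_scalar: "aff_mat k 1 0 = mat k"
  by (rule matrix_eqI_vec4) (simp add: aff_mat_def mat_vec4_mult)

lemma aff_mat_inverse:
  assumes "k \<noteq> 0" "a \<noteq> 0"
  shows "aff_mat k a b ** aff_mat (1 / k) (1 / a) (- b / a) = mat 1"
    and "aff_mat (1 / k) (1 / a) (- b / a) ** aff_mat k a b = mat 1"
  using assms by (simp_all add: aff_mat_mult flip: aff_mat_scalar)

lemma aff_mat_cubic_vec: "aff_mat k a b *v cubic_vec s = k *s cubic_vec (a * s + b)"
  by (simp add: aff_mat_def cubic_vec_def algebra_simps power2_eq_square power3_eq_cube)

lemma proj_map_aff_mat_cubic:
  "k \<noteq> 0 \<Longrightarrow> proj_map (aff_mat k a b) (pspan (cubic_vec s)) = pspan (cubic_vec (a * s + b))"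
  by (simp add: proj_map_pspan aff_mat_cubic_vec pspan_smult)

lemma proj_map_aff_mat_P0:
  assumes "k \<noteq> 0" "a \<noteq> 0" shows "proj_map (aff_mat k a b) P0 = P0"
  using pspan_smult[of "k * a^3" "vec4 0 0 0 1"] assms by (simp add: proj_map_pspan aff_mat_def)

lemma proj_map_rev_mat_P0: "proj_map rev_mat P0 = pspan (cubic_vec 0)"
  by (simp add: proj_map_pspan rev_mat_def cubic_vec_def)

lemma proj_map_rev_mat_cubic_0: "proj_map rev_mat (pspan (cubic_vec 0)) = P0"
  by (simp add: proj_map_pspan rev_mat_def cubic_vec_def)

lemma proj_map_rev_mat_cubic:
  assumes "s \<noteq> 0" shows "proj_map rev_mat (pspan (cubic_vec s)) = pspan (cubic_vec (1 / s))"
  using pspan_smult[of "s^3" "cubic_vec (1 / s)"] assms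
  by (simp add: proj_map_pspan rev_mat_def cubic_vec_def field_simps power2_eq_square power3_eq_cube)

text \<open>Each \<open>P\<close> is the image of \<open>proj_map B P\<close>, so two inclusions,
  for the matrix and for its inverse, replace the equality of sets.\<close>

lemma GqI:
  assumes AB: "A ** B = mat 1" "B ** A = mat 1"
    and "\<And>P. P \<in> twisted_cubic \<Longrightarrow> proj_map A P \<in> twisted_cubic"
    and "\<And>P. P \<in> twisted_cubic \<Longrightarrow> proj_map B P \<in> twisted_cubic"
  shows "A \<in> Gq"
proof -
  have "P \<in> proj_map A ` twisted_cubic" if "P \<in> twisted_cubic" for P
    by (metis AB(1) assms(4) image_eqI proj_map_mat_1 proj_map_mult that)
  then show ?thesis using assms by (auto simp: Gq_def invertible_def)
qed

lemma rev_mat_Gq: "rev_mat \<in> Gq"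
proof -
  have "proj_map rev_mat P \<in> twisted_cubic" if P: "P \<in> twisted_cubic" for P :: "('a^4) set"
  proof -
    consider "P = P0" | s where "P = pspan (cubic_vec s)" using P by (auto simp: twisted_cubic_eq)
    then show ?thesis
      by cases (metis insertCI proj_map_rev_mat_P0 proj_map_rev_mat_cubic proj_map_rev_mat_cubic_0
          rangeI twisted_cubic_eq)+
  qed
  then show ?thesis using GqI[OF rev_mat_mult_self rev_mat_mult_self] by blast
qed

lemma aff_mat_Gq:
  assumes "k \<noteq> 0" "a \<noteq> 0" shows "aff_mat k a b \<in> Gq"
proof -
  have "proj_map (aff_mat k a b) P \<in> twisted_cubic"
    if "P \<in> twisted_cubic" "k \<noteq> 0" "a \<noteq> 0" for k a b and P :: "('a^4) set"
    using that by (auto simp: twisted_cubic_eq proj_map_aff_mat_P0 proj_map_aff_mat_cubic)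
  then show ?thesis
    using GqI[OF aff_mat_inverse[OF assms]] assms by (metis divide_eq_0_iff one_neq_zero)
qed

lemma Gq_mult:
  assumes "A \<in> Gq" "B \<in> Gq" shows "A ** B \<in> Gq"
proof -
  have "proj_map (A ** B) ` twisted_cubic = proj_map A ` proj_map B ` twisted_cubic"
    by (simp add: image_image proj_map_mult)
  then show ?thesis using assms by (simp add: Gq_def invertible_mult)
qed

lemma Gq_inverse:
  assumes "A \<in> Gq" obtains B where "B \<in> Gq" "A ** B = mat 1" "B ** A = mat 1"
proof -
  obtain B where B: "A ** B = mat 1" "B ** A = mat 1"
    using assms by (auto simp: Gq_def invertible_def)
  have "proj_map B ` twisted_cubic = proj_map B ` proj_map A ` twisted_cubic"
    using assms by (simp add: Gq_def)
  also have "\<dots> = twisted_cubic"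
    by (simp add: image_image B proj_map_mat_1 flip: proj_map_mult)
  finally have "B \<in> Gq" using B by (auto simp: Gq_def invertible_def)
  then show thesis using that B by blast
qed

lemma Gq_twisted_cubic: "A \<in> Gq \<Longrightarrow> P \<in> twisted_cubic \<Longrightarrow> proj_map A P \<in> twisted_cubic"
  by (auto simp: Gq_def)

lemma Gq_invertible: "A \<in> Gq \<Longrightarrow> invertible A"
  by (simp add: Gq_def)

section \<open>Quadrics through the cubic and stabilisers of its points\<close>

text \<open>Two of the quadrics through the cubic. Being homogeneous, they hold for every vector
  representing a point.\<close>

lemma twisted_cubic_relations:
  assumes "pspan v \<in> twisted_cubic" "v \<noteq> 0"
  shows "v $ 0 * v $ 2 = (v $ 1)^2" "v $ 1 * v $ 3 = (v $ 2)^2"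
proof -
  consider "pspan v = P0" | s where "pspan v = pspan (cubic_vec s)"
    using assms by (auto simp: twisted_cubic_eq)
  then have "v $ 0 * v $ 2 = (v $ 1)^2 \<and> v $ 1 * v $ 3 = (v $ 2)^2"
  proof cases
    case 1
    then obtain k where "v = k *s vec4 0 0 0 1" using pspan_eqD[OF _ assms(2)] by metis
    then show ?thesis by simp
  next
    case (2 s)
    then obtain k where "v = k *s cubic_vec s" using pspan_eqD[OF _ assms(2)] by metis
    then show ?thesis by (simp add: cubic_vec_def power2_eq_square power3_eq_cube)
  qed
  then show "v $ 0 * v $ 2 = (v $ 1)^2" "v $ 1 * v $ 3 = (v $ 2)^2" by auto
qed

lemma poly_zero_if_degree_less_card:
  fixes p :: "'a::{finite,field} poly"
  assumes "\<And>x. poly p x = 0" "degree p < CARD('a)"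
  shows "p = 0"
proof (rule ccontr)
  assume "p \<noteq> 0"
  from card_poly_roots_bound[OF this] assms show False by simp
qed

text \<open>Allows comparison of coefficients: a nonzero polynomial of degree at most 5 has at most
  5 roots, too few to exhaust the field.\<close>

lemma degree5_vanishing:
  fixes c0 :: "'a::{finite,field}"
  assumes "\<And>s. c0 + c1 * s + c2 * s^2 + c3 * s^3 + c4 * s^4 + c5 * s^5 = 0" "CARD('a) > 5"
  shows "c0 = 0 \<and> c1 = 0 \<and> c2 = 0 \<and> c3 = 0 \<and> c4 = 0 \<and> c5 = 0"
proof -
  let ?p = "[:c0, c1, c2, c3, c4, c5:]"
  have "?p = 0"
  proof (rule poly_zero_if_degree_less_card)
    show "poly ?p s = 0" for s
      using assms(1)[of s] by (simp add: algebra_simps power_numeral_reduce)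
    have "degree ?p \<le> 5" by (simp add: degree_pCons_eq_if)
    then show "degree ?p < CARD('a)" using assms(2) by linarith
  qed
  then show ?thesis by simp
qed

text \<open>The quadratic equations of the cubic, evaluated along the image of the cubic, are polynomials
  in \<open>s\<close> of degree at most 5; they vanish identically because the field has more than 5 elements.\<close>

lemma Gq_fix_two_points:
  fixes A :: "'a::{finite,field}^4^4"
  assumes A: "A \<in> Gq" and q: "CARD('a) > 5"
    and fix0: "proj_map A P0 = P0"
    and fix1: "proj_map A (pspan (cubic_vec 0)) = pspan (cubic_vec 0)"
  obtains k a where "k \<noteq> 0" "a \<noteq> 0" "A = aff_mat k a 0"
proof -
  obtain r0 r1 r2 r3 where "A = vec4 r0 r1 r2 r3" by (rule vec4_cases)
  obtain k p1 p2 p3 where r0: "r0 = vec4 k p1 p2 p3" by (rule vec4_cases)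
  obtain q0 q1 q2 q3 where r1: "r1 = vec4 q0 q1 q2 q3" by (rule vec4_cases)
  obtain u0 u1 u2 u3 where r2: "r2 = vec4 u0 u1 u2 u3" by (rule vec4_cases)
  obtain w0 w1 w2 w3 where r3: "r3 = vec4 w0 w1 w2 w3" by (rule vec4_cases)
  note A_eq = \<open>A = vec4 r0 r1 r2 r3\<close>[unfolded r0 r1 r2 r3]
  have inv: "A *v x = 0 \<longleftrightarrow> x = 0" for x
    using invertible_mult_cancel[OF Gq_invertible[OF A], of x 0] by simp
  \<comment> \<open>Fixing \<open>P0\<close> determines the last column up to a factor; fixing
    P(1,0,0,0) does the same for the first column.\<close>
  have "pspan (A *v vec4 0 0 0 1) = P0" using fix0 by (simp add: proj_map_pspan)
  then obtain d where "d \<noteq> 0" "A *v vec4 0 0 0 1 = d *s vec4 0 0 0 1"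
    by (rule pspan_eqD) (simp add: inv)
  then have col3: "p3 = 0" "q3 = 0" "u3 = 0" "w3 \<noteq> 0" by (simp_all add: A_eq)
  have "pspan (A *v vec4 1 0 0 0) = pspan (vec4 1 0 0 0)"
    using fix1 by (simp add: proj_map_pspan cubic_vec_def)
  then obtain d where "d \<noteq> 0" "A *v vec4 1 0 0 0 = d *s vec4 1 0 0 0"
    by (rule pspan_eqD) (simp add: inv)
  then have col0: "k \<noteq> 0" "q0 = 0" "u0 = 0" "w0 = 0" by (simp_all add: A_eq)
  have img: "pspan (A *v cubic_vec s) \<in> twisted_cubic" "A *v cubic_vec s \<noteq> 0" for s
  proof -
    show "pspan (A *v cubic_vec s) \<in> twisted_cubic"
      using Gq_twisted_cubic[OF A, of "pspan (cubic_vec s)"]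
      by (simp add: twisted_cubic_eq flip: proj_map_pspan)
    show "A *v cubic_vec s \<noteq> 0" by (simp add: inv cubic_vec_def)
  qed
  have img_eq: "A *v cubic_vec s = vec4 (k + p1 * s + p2 * s^2) (q1 * s + q2 * s^2)
      (u1 * s + u2 * s^2) (w1 * s + w2 * s^2 + w3 * s^3)" for s
    by (simp add: A_eq cubic_vec_def col0 col3)
  \<comment> \<open>This is \<open>x0 x2 - x1^2\<close> along the image, and \<open>rel2\<close> is
    \<open>x1 x3 - x2^2\<close>; zero coefficients pad both to the shape of
    \<open>degree5_vanishing\<close>.\<close>
  have rel1: "0 + (k * u1) * s + (k * u2 + p1 * u1 - q1^2) * s^2
      + (p1 * u2 + p2 * u1 - 2 * q1 * q2) * s^3 + (p2 * u2 - q2^2) * s^4 + 0 * s^5 = 0" for s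
    using twisted_cubic_relations(1)[OF img[of s]]
    by (simp add: img_eq algebra_simps power_numeral_reduce)
  have rel2: "0 + 0 * s + (q1 * w1 - u1^2) * s^2
      + (q1 * w2 + q2 * w1 - 2 * u1 * u2) * s^3 + (q1 * w3 + q2 * w2 - u2^2) * s^4
      + (q2 * w3) * s^5 = 0" for s
    using twisted_cubic_relations(2)[OF img[of s]]
    by (simp add: img_eq algebra_simps power_numeral_reduce)
  \<comment> \<open>From the coefficients \<open>k * u1\<close> and \<open>q2 * w3\<close>, where
    \<open>k\<close> and \<open>w3\<close> are nonzero.\<close>
  have "u1 = 0" "q2 = 0"
    using degree5_vanishing[OF rel1 q] degree5_vanishing[OF rel2 q] col0 col3 by auto
  moreover from this have c: "k * u2 = q1^2" "p1 * u2 = 0" "p2 * u2 = 0"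
      "q1 * w1 = 0" "q1 * w2 = 0" "q1 * w3 = u2^2"
    using degree5_vanishing[OF rel1 q] degree5_vanishing[OF rel2 q] by auto
  moreover have "q1 \<noteq> 0"
  proof
    assume "q1 = 0"
    \<comment> \<open>With \<open>q1 = 0\<close>, the second column is a combination of the first
      and the last, which gives this kernel vector.\<close>
    then have "A *v vec4 (- p1 / k) 1 0 (- w1 / w3) = 0"
      using c col0 col3 \<open>u1 = 0\<close> \<open>q2 = 0\<close> by (simp add: A_eq)
    then show False by (simp add: inv)
  qed
  \<comment> \<open>Since \<open>k * u2 = q1^2\<close>, also \<open>u2\<close> is nonzero.\<close>
  ultimately have "p1 = 0" "p2 = 0" "w1 = 0" "w2 = 0" using col0 by auto
  moreover have "u2 = k * (q1 / k)^2" "w3 = k * (q1 / k)^3"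
  proof -
    show u2: "u2 = k * (q1 / k)^2"
      using c(1) col0(1) by (simp add: field_simps power2_eq_square)
    have "q1 * w3 = q1 * (k * (q1 / k)^3)"
      unfolding c(6) u2 using col0(1) by (simp add: field_simps power2_eq_square power3_eq_cube)
    then show "w3 = k * (q1 / k)^3" using \<open>q1 \<noteq> 0\<close> by simp
  qed
  ultimately have "A = aff_mat k (q1 / k) 0"
    using col0 col3 \<open>u1 = 0\<close> \<open>q2 = 0\<close> by (simp add: A_eq aff_mat_def)
  then show thesis using that[of k "q1 / k"] col0(1) \<open>q1 \<noteq> 0\<close> by simp
qed

text \<open>A translation brings the image of the point \<open>s = 0\<close> back to it without
  moving \<open>P0\<close>, which reduces to the case of two fixed points.\<close>

lemma Gq_fix_P0:
  fixes A :: "'a::{finite,field}^4^4"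
  assumes A: "A \<in> Gq" and q: "CARD('a) > 5" and fix0: "proj_map A P0 = P0"
  obtains k a b where "k \<noteq> 0" "a \<noteq> 0" "A = aff_mat k a b"
proof -
  have "proj_map A (pspan (cubic_vec 0)) \<noteq> P0"
    using inj_proj_map[OF Gq_invertible[OF A]] fix0 pspan_cubic_vec_neq_P0 by (metis injD)
  then obtain s where s: "proj_map A (pspan (cubic_vec 0)) = pspan (cubic_vec s)"
    using Gq_twisted_cubic[OF A, of "pspan (cubic_vec 0)"] by (auto simp: twisted_cubic_eq)
  have "aff_mat 1 1 (- s) ** A \<in> Gq" by (intro Gq_mult A aff_mat_Gq) auto
  moreover have "proj_map (aff_mat 1 1 (- s) ** A) P0 = P0"
    by (simp add: proj_map_mult fix0 proj_map_aff_mat_P0)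
  moreover have "proj_map (aff_mat 1 1 (- s) ** A) (pspan (cubic_vec 0)) = pspan (cubic_vec 0)"
    by (simp add: proj_map_mult s proj_map_aff_mat_cubic)
  ultimately obtain k a where ka: "k \<noteq> 0" "a \<noteq> 0" "aff_mat 1 1 (- s) ** A = aff_mat k a 0"
    using Gq_fix_two_points[OF _ q] by metis
  have "A = aff_mat 1 1 s ** (aff_mat 1 1 (- s) ** A)"
    by (simp add: matrix_mul_assoc aff_mat_mult aff_mat_scalar)
  also have "\<dots> = aff_mat k a s" by (simp add: ka aff_mat_mult)
  finally show thesis using that ka by blast
qed

text \<open>Translate the point to parameter 0, then reverse. This transitivity reduces questions
  about the group to the stabiliser of \<open>P0\<close>.\<close>

lemma twisted_cubic_to_P0:
  assumes "P \<in> twisted_cubic"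
  obtains "P = P0" | s where "proj_map (rev_mat ** aff_mat 1 1 (- s)) P = P0"
proof -
  consider "P = P0" | s where "P = pspan (cubic_vec s)"
    using assms by (auto simp: twisted_cubic_eq)
  then show thesis
  proof cases
    case (2 s)
    then have "proj_map (rev_mat ** aff_mat 1 1 (- s)) P = P0"
      by (simp add: proj_map_mult proj_map_aff_mat_cubic proj_map_rev_mat_cubic_0)
    then show thesis using that by blast
  qed (use that in blast)
qed

section \<open>Osculating planes\<close>

lemma plane_smult: "k \<noteq> 0 \<Longrightarrow> plane (k *s c) = plane c"
proof -
  assume "k \<noteq> 0"
  have "(\<Sum>i\<in>UNIV. (k *s c) $ i * x $ i) = k * (\<Sum>i\<in>UNIV. c $ i * x $ i)" for x
    by (simp add: sum_distrib_left mult.assoc)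
  then show ?thesis using \<open>k \<noteq> 0\<close> by (simp add: plane_def)
qed

text \<open>On \<open>cubic_vec x\<close> this linear form takes the value \<open>(x - s)^3\<close>:
  the plane has triple contact at \<open>s\<close>. The osculating plane at \<open>P0\<close> is
  \<open>plane (vec4 1 0 0 0)\<close>.\<close>

definition osc_vec :: "'a::field \<Rightarrow> 'a^4" where
  "osc_vec s = vec4 (- (s^3)) (3 * s^2) (- (3 * s)) 1"

lemma osc_planes_eq:
  "plane ` osc_coeffs = insert (plane (vec4 1 0 0 0)) (range (\<lambda>s. plane (osc_vec s)))"
proof -
  have *: "plane (vec4 1 (-3*t) (3*t^2) (-(t^3))) = plane (osc_vec (1 / t))" if "t \<noteq> 0" for t :: 'a
    using plane_smult[of "- (t^3)" "osc_vec (1 / t)"] that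
    by (simp add: osc_vec_def field_simps power2_eq_square power3_eq_cube)
  show ?thesis
  proof (intro equalityI subsetI)
    fix P :: "('a^4) set" assume "P \<in> plane ` osc_coeffs"
    then consider t where "P = plane (vec4 1 (-3*t) (3*t^2) (-(t^3)))" | "P = plane (vec4 0 0 0 1)"
      by (auto simp: osc_coeffs_def)
    then show "P \<in> insert (plane (vec4 1 0 0 0)) (range (\<lambda>s. plane (osc_vec s)))"
    proof cases
      case (1 t)
      then show ?thesis using *[of t] by (cases "t = 0") auto
    next
      case 2
      then have "P = plane (osc_vec 0)" by (simp add: osc_vec_def)
      then show ?thesis by blast
    qed
  next
    fix P :: "('a^4) set"
    assume "P \<in> insert (plane (vec4 1 0 0 0)) (range (\<lambda>s. plane (osc_vec s)))"
    then consider "P = plane (vec4 1 0 0 0)" | s where "P = plane (osc_vec s)" by auto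
    then show "P \<in> plane ` osc_coeffs"
    proof cases
      case 1
      then have "P = plane (vec4 1 (-3*0) (3*0^2) (-(0^3)))" by simp
      then show ?thesis unfolding osc_coeffs_def by blast
    next
      case (2 s)
      show ?thesis
      proof (cases "s = 0")
        case True
        then have "P = plane (vec4 0 0 0 1)" by (simp add: 2 osc_vec_def)
        then show ?thesis unfolding osc_coeffs_def by blast
      next
        case False
        define t where "t = 1 / s"
        have "P = plane (vec4 1 (-3*t) (3*t^2) (-(t^3)))"
          using *[of t] 2 False by (simp add: t_def)
        then show ?thesis unfolding osc_coeffs_def by blast
      qed
    qed
  qed
qed

text \<open>Only an inclusion of preimages is recorded: it composes well, and it already shows that
  a line whose image lies in an osculating plane lies in one itself.\<close>

definition osc_stable :: "'a::field^4^4 \<Rightarrow> bool" where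
  "osc_stable A \<longleftrightarrow> (\<forall>H \<in> plane ` osc_coeffs. \<exists>H' \<in> plane ` osc_coeffs. \<forall>x. A *v x \<in> H \<longrightarrow> x \<in> H')"

lemma osc_stable_mult:
  assumes "osc_stable A" "osc_stable B" shows "osc_stable (A ** B)"
  using assms unfolding osc_stable_def by (metis matrix_vector_mul_assoc)

lemma osc_stable_rev_mat: "osc_stable rev_mat"
  unfolding osc_stable_def
proof
  fix H :: "('a^4) set" assume "H \<in> plane ` osc_coeffs"
  then consider "H = plane (vec4 1 0 0 0)" | "H = plane (osc_vec 0)"
    | s where "s \<noteq> 0" "H = plane (osc_vec s)"
    unfolding osc_planes_eq by (metis insertE rangeE)
  then show "\<exists>H'\<in>plane ` osc_coeffs. \<forall>x. rev_mat *v x \<in> H \<longrightarrow> x \<in> H'"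
  proof cases
    case 1
    have "\<forall>x. rev_mat *v x \<in> H \<longrightarrow> x \<in> plane (osc_vec 0)"
    proof
      fix x :: "'a^4"
      show "rev_mat *v x \<in> H \<longrightarrow> x \<in> plane (osc_vec 0)"
        by (cases x rule: vec4_cases) (simp add: 1 rev_mat_def osc_vec_def)
    qed
    then show ?thesis unfolding osc_planes_eq by blast
  next
    case 2
    have "\<forall>x. rev_mat *v x \<in> H \<longrightarrow> x \<in> plane (vec4 1 0 0 0)"
    proof
      fix x :: "'a^4"
      show "rev_mat *v x \<in> H \<longrightarrow> x \<in> plane (vec4 1 0 0 0)"
        by (cases x rule: vec4_cases) (simp add: 2 rev_mat_def osc_vec_def)
    qed
    then show ?thesis unfolding osc_planes_eq by blast
  next
    case (3 s)
    \<comment> \<open>Pulling a plane back along \<open>rev_mat\<close> reverses its coefficients,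
      and \<open>osc_vec s\<close> reversed is \<open>- (s^3)\<close> times
      \<open>osc_vec (1 / s)\<close>.\<close>
    have "plane (osc_vec (1 / s)) = plane (- (s^3) *s osc_vec (1 / s))"
      using 3 by (subst plane_smult) auto
    then have "plane (osc_vec (1 / s)) = plane (vec4 1 (- 3 * s) (3 * s^2) (- (s^3)))"
      using 3 by (simp add: osc_vec_def field_simps power2_eq_square power3_eq_cube)
    moreover have "x \<in> plane (vec4 1 (- 3 * s) (3 * s^2) (- (s^3)))" if "rev_mat *v x \<in> H" for x
      using that
      by (cases x rule: vec4_cases) (simp add: 3 rev_mat_def osc_vec_def algebra_simps)
    ultimately show ?thesis unfolding osc_planes_eq by blast
  qed
qed

lemma osc_stable_aff_mat:
  assumes "k \<noteq> 0" "a \<noteq> 0" shows "osc_stable (aff_mat k a b)"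
  unfolding osc_stable_def
proof
  fix H :: "('a^4) set" assume "H \<in> plane ` osc_coeffs"
  then consider "H = plane (vec4 1 0 0 0)" | s where "H = plane (osc_vec s)"
    by (auto simp: osc_planes_eq)
  then show "\<exists>H'\<in>plane ` osc_coeffs. \<forall>x. aff_mat k a b *v x \<in> H \<longrightarrow> x \<in> H'"
  proof cases
    case 1
    have "x \<in> plane (vec4 1 0 0 0)" if "aff_mat k a b *v x \<in> H" for x
      using that assms by (cases x rule: vec4_cases) (simp add: 1 aff_mat_def)
    then show ?thesis unfolding osc_planes_eq by blast
  next
    case (2 s)
    \<comment> \<open>The parameter sent to \<open>s\<close>. As
      \<open>(a x + b - s)^3 = a^3 (x - u)^3\<close>, the form pulls back to \<open>k * a^3\<close>
      times the one at \<open>u\<close>.\<close>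
    define u where "u = (s - b) / a"
    have s: "s = a * u + b" using assms by (simp add: u_def)
    have "x \<in> plane (osc_vec u)" if "aff_mat k a b *v x \<in> H" for x
    proof (cases x rule: vec4_cases)
      case (1 x0 x1 x2 x3)
      have "k * a^3 * (- (u^3) * x0 + 3 * u^2 * x1 + - (3 * u) * x2 + 1 * x3) = 0"
        using that
        by (simp add: 1 2 s aff_mat_def osc_vec_def algebra_simps power2_eq_square power3_eq_cube)
      then show ?thesis using assms by (simp add: 1 osc_vec_def)
    qed
    then show ?thesis unfolding osc_planes_eq by blast
  qed
qed

text \<open>After \<open>A\<close>, a translation and the reversal bring the image of
  \<open>P0\<close> back to \<open>P0\<close>. The product is some \<open>aff_mat\<close>, so
  \<open>A\<close> is a product of matrices already treated.\<close>

lemma Gq_osc_stable: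
  fixes A :: "'a::{finite,field}^4^4"
  assumes A: "A \<in> Gq" and q: "CARD('a) > 5"
  shows "osc_stable A"
proof -
  have base: "osc_stable B" if "B \<in> Gq" "proj_map B P0 = P0" for B :: "'a^4^4"
    using Gq_fix_P0[OF that(1) q that(2)] osc_stable_aff_mat by metis
  have "proj_map A P0 \<in> twisted_cubic"
    using Gq_twisted_cubic[OF A] by (simp add: twisted_cubic_eq)
  then show ?thesis
  proof (cases rule: twisted_cubic_to_P0)
    case 1
    then show ?thesis using base A by blast
  next
    case (2 s)
    let ?B = "rev_mat ** aff_mat 1 1 (- s) ** A"
    have "osc_stable ?B"
      by (intro base Gq_mult rev_mat_Gq aff_mat_Gq A) (use 2 in \<open>simp_all add: proj_map_mult\<close>)
    moreover have "A = aff_mat 1 1 s ** rev_mat ** ?B"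
    proof -
      have "aff_mat 1 1 s ** rev_mat ** ?B
          = aff_mat 1 1 s ** (rev_mat ** rev_mat) ** aff_mat 1 1 (- s) ** A"
        by (simp only: matrix_mul_assoc)
      then show ?thesis by (simp add: rev_mat_mult_self aff_mat_mult aff_mat_scalar)
    qed
    ultimately show ?thesis
      by (metis osc_stable_mult osc_stable_rev_mat osc_stable_aff_mat one_neq_zero)
  qed
qed

section \<open>Unisecants not in osculating planes\<close>

lemma UnGamma_line_iff:
  "UnGamma_line L \<longleftrightarrow> is_line L \<and> (\<exists>!P. P \<in> twisted_cubic \<and> P \<subseteq> L)
     \<and> (\<forall>H \<in> plane ` osc_coeffs. \<not> L \<subseteq> H)"
  by (auto simp: UnGamma_line_def card_1_singleton_iff Ex1_def) blast+

lemma UnGamma_line_ex: "UnGamma_line L \<Longrightarrow> \<exists>P \<in> twisted_cubic. P \<subseteq> L"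
  by (metis UnGamma_line_iff)

lemma UnGamma_line_unique:
  "UnGamma_line L \<Longrightarrow> P \<in> twisted_cubic \<Longrightarrow> P \<subseteq> L \<Longrightarrow> Q \<in> twisted_cubic \<Longrightarrow> Q \<subseteq> L \<Longrightarrow> P = Q"
  by (metis UnGamma_line_iff)

text \<open>\<open>A\<close> permutes the points of the cubic, so the single common point is carried
  along; an osculating plane through the image would pull back to one through
  \<open>L\<close>.\<close>

lemma UnGamma_line_proj_map:
  fixes A :: "'a::{finite,field}^4^4"
  assumes A: "A \<in> Gq" and q: "CARD('a) > 5" and L: "UnGamma_line L"
  shows "UnGamma_line (proj_map A L)"
  unfolding UnGamma_line_iff
proof (intro conjI ballI)
  have inv: "invertible A" using A by (rule Gq_invertible)
  show "is_line (proj_map A L)" using is_line_proj_map inv L by (auto simp: UnGamma_line_def)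
  obtain P where P: "P \<in> twisted_cubic" "P \<subseteq> L"
    using UnGamma_line_ex[OF L] by blast
  show "\<exists>!P. P \<in> twisted_cubic \<and> P \<subseteq> proj_map A L"
  proof (rule ex1I[of _ "proj_map A P"])
    show "proj_map A P \<in> twisted_cubic \<and> proj_map A P \<subseteq> proj_map A L"
      using P A inv by (simp add: Gq_twisted_cubic proj_map_mono_iff)
  next
    fix Q assume Q: "Q \<in> twisted_cubic \<and> Q \<subseteq> proj_map A L"
    then obtain R where "R \<in> twisted_cubic" "Q = proj_map A R"
      using A unfolding Gq_def by blast
    then show "Q = proj_map A P"
      using UnGamma_line_unique[OF L, of R P] P Q inv by (simp add: proj_map_mono_iff)
  qed
next
  fix H assume "H \<in> plane ` (osc_coeffs :: ('a^4) set)"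
  then obtain H' where H': "H' \<in> plane ` osc_coeffs" "\<And>x. A *v x \<in> H \<Longrightarrow> x \<in> H'"
    using Gq_osc_stable[OF A q] unfolding osc_stable_def by blast
  then have "\<not> L \<subseteq> H'" using L unfolding UnGamma_line_iff by blast
  then show "\<not> proj_map A L \<subseteq> H" using H'(2) by (auto simp: proj_map_def)
qed

section \<open>The model line\<close>

lemma is_line_ell0: "is_line (ell0 :: ('a::field^4) set)"
  unfolding is_line_def ell0_def
  by (intro exI[of _ "vec4 0 0 0 1"] exI[of _ "vec4 1 0 1 0"]) simp

lemma mem_ell0: "vec4 a b c d \<in> ell0 \<longleftrightarrow> b = 0 \<and> a = c"
  by (auto simp: ell0_def lspan_def)

lemma cubic_vec_ell0: "cubic_vec s \<notin> ell0"
  by (auto simp: cubic_vec_def mem_ell0)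

lemma twisted_cubic_ell0:
  "P \<in> twisted_cubic \<and> P \<subseteq> ell0 \<longleftrightarrow> P = P0"
proof
  assume P: "P \<in> twisted_cubic \<and> P \<subseteq> ell0"
  then have "pspan (cubic_vec s) \<noteq> P" for s using cubic_vec_ell0 pspan_mem by blast
  then show "P = P0" using P by (auto simp: twisted_cubic_eq)
qed (auto simp: is_line_pspan_subset_iff[OF is_line_ell0] mem_ell0 twisted_cubic_eq)

lemma UnGamma_line_ell0: "UnGamma_line (ell0 :: ('a::field^4) set)"
  unfolding UnGamma_line_iff
proof (intro conjI ballI)
  show "is_line (ell0 :: ('a^4) set)" by (rule is_line_ell0)
  show "\<exists>!P. P \<in> twisted_cubic \<and> P \<subseteq> (ell0 :: ('a^4) set)"
    unfolding twisted_cubic_ell0 by blast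
  fix H assume "H \<in> plane ` (osc_coeffs :: ('a^4) set)"
  moreover have "vec4 0 0 0 1 \<in> ell0" "vec4 1 0 1 0 \<in> ell0" by (simp_all add: mem_ell0)
  \<comment> \<open>\<open>P0\<close> lies on no osculating plane but its own, and the second
    generator avoids that one.\<close>
  moreover have "vec4 0 0 0 1 \<notin> plane (osc_vec s)" "vec4 1 0 1 0 \<notin> plane (vec4 1 0 0 0)" for s :: 'a
    by (simp_all add: osc_vec_def)
  ultimately show "\<not> ell0 \<subseteq> H" by (auto simp: osc_planes_eq)
qed

text \<open>The product of all nonzero elements equals the product of their negatives, which is
  \<open>(- 1) ^ (q - 1)\<close> times it.\<close>

lemma even_card_field_two_eq_0:
  assumes "even CARD('a::{finite,field})"
  shows "(2 :: 'a) = 0"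
proof -
  let ?N = "UNIV - {0 :: 'a}"
  define m where "m = prod (\<lambda>x. x) ?N"
  have "odd (card ?N)" using assms by (simp add: card_Diff_singleton)
  have "m = prod (\<lambda>x. - x) ?N"
    unfolding m_def by (rule prod.reindex_bij_witness[of _ uminus uminus]) auto
  also have "\<dots> = (- 1) ^ card ?N * m"
    by (simp add: prod_uminus m_def)
  also have "\<dots> = - m" using \<open>odd (card ?N)\<close> by simp
  finally have "m + m = m + - m" by (rule arg_cong)
  then have "2 * m = 0" unfolding mult_2 by (simp only: add.right_inverse)
  moreover have "m \<noteq> 0" by (simp add: m_def)
  ultimately show ?thesis by simp
qed

section \<open>Squaring in characteristic 2\<close>

text \<open>\<open>(x - y)^2\<close> and \<open>x^2 - y^2\<close> differ by a multiple of 2.\<close>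

lemma char2_square_eq_iff:
  fixes x y :: "'a::field"
  assumes "(2 :: 'a) = 0" shows "x^2 = y^2 \<longleftrightarrow> x = y"
proof
  assume "x^2 = y^2"
  moreover have "(x - y)^2 = x^2 - y^2 + 2 * (y^2 - x * y)"
    by (simp add: power2_eq_square algebra_simps)
  ultimately have "(x - y)^2 = 0" using assms by simp
  then show "x = y" by simp
qed simp

text \<open>Squaring is injective on a finite set, hence onto.\<close>

lemma char2_square_root:
  fixes x :: "'a::{finite,field}"
  assumes "(2 :: 'a) = 0"
  obtains y where "y^2 = x"
proof -
  have "inj (\<lambda>y::'a. y^2)" by (rule injI) (simp add: char2_square_eq_iff[OF assms])
  then have "surj (\<lambda>y::'a. y^2)" by (simp add: finite_UNIV_inj_surj)
  then obtain y :: 'a where "x = y^2" by (rule surjE)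
  then show thesis using that by blast
qed

section \<open>Orbit and stabiliser\<close>

lemma UnGamma_line_P0_eq:
  fixes L :: "('a::{finite,field}^4) set"
  assumes two: "(2 :: 'a) = 0" and L: "UnGamma_line L" and P0: "P0 \<subseteq> L"
  obtains a b where "a \<noteq> 0" "L = proj_map (aff_mat 1 a b) ell0"
proof -
  have line: "is_line L" using L by (simp add: UnGamma_line_def)
  have e3: "vec4 0 0 0 1 \<in> L" using P0 pspan_mem by blast
  \<comment> \<open>The osculating plane at \<open>P0\<close> is \<open>x0 = 0\<close>, so some
    point of \<open>L\<close> can be normalised to first coordinate 1.\<close>
  have "\<not> L \<subseteq> plane (vec4 1 0 0 0)" using L by (simp add: UnGamma_line_iff osc_planes_eq)
  then obtain x where x: "x \<in> L" "x \<notin> plane (vec4 1 0 0 0)" by blast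
  obtain x0 x1 x2 x3 where x_eq: "x = vec4 x0 x1 x2 x3" by (rule vec4_cases)
  have x0: "x0 \<noteq> 0" using x by (simp add: x_eq)
  define b c where "b = x1 / x0" and "c = x2 / x0"
  have mem: "vec4 1 b c d \<in> L" for d
    using is_line_lincomb[OF line x(1) e3, of "1 / x0" "d - x3 / x0"] x0
    by (simp add: x_eq b_def c_def)
  \<comment> \<open>Otherwise \<open>L\<close> would meet the cubic a second time, at parameter
    \<open>b\<close>.\<close>
  have "c \<noteq> b^2"
  proof
    assume "c = b^2"
    then have "cubic_vec b \<in> L" using mem by (simp add: cubic_vec_def)
    then have "pspan (cubic_vec b) \<subseteq> L" by (simp add: is_line_pspan_subset_iff[OF line])
    moreover have "pspan (cubic_vec b) \<in> twisted_cubic" "P0 \<in> (twisted_cubic :: ('a^4) set set)"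
      by (simp_all add: twisted_cubic_eq)
    ultimately have "pspan (cubic_vec b) = P0"
      using UnGamma_line_unique[OF L] P0 by metis
    then show False using pspan_cubic_vec_neq_P0 by blast
  qed
  \<comment> \<open>The image of P(1,0,1,0) under \<open>aff_mat 1 a b\<close> has third coordinate
    \<open>a^2 + b^2\<close>, which must equal \<open>c\<close>.\<close>
  obtain a where a: "a^2 = c - b^2" using char2_square_root[OF two] by blast
  then have "a \<noteq> 0" using \<open>c \<noteq> b^2\<close> by auto
  have "proj_map (aff_mat 1 a b) ell0
      = lspan (vec4 0 0 0 (a^3)) (vec4 1 b c (b^3 + 3 * a^2 * b))"
    using a by (simp add: ell0_def proj_map_lspan aff_mat_def)
  also have "\<dots> = L"
  proof (rule is_line_eq_lspan[OF line, symmetric])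
    show "vec4 0 0 0 (a^3) \<in> L" using is_line_lincomb[OF line e3 e3, of "a^3" 0] by simp
    show "x = 0 \<and> y = 0"
      if "x *s vec4 0 0 0 (a^3) + y *s vec4 1 b c (b^3 + 3 * a^2 * b) = 0" for x y
      using that \<open>a \<noteq> 0\<close> by auto
  qed (rule mem)
  finally show thesis using that \<open>a \<noteq> 0\<close> by blast
qed

text \<open>Some \<open>B\<close> in \<open>Gq\<close> moves the cubic point of \<open>L\<close> to
  \<open>P0\<close>; the moved line is an affine image of \<open>ell0\<close>, and the inverse of
  \<open>B\<close> carries it back.\<close>

lemma UnGamma_line_orbit:
  fixes L :: "('a::{finite,field}^4) set"
  assumes two: "(2 :: 'a) = 0" and q: "CARD('a) > 5" and L: "UnGamma_line L"
  obtains A where "A \<in> Gq" "L = proj_map A ell0"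
proof -
  obtain P where P: "P \<in> twisted_cubic" "P \<subseteq> L" using UnGamma_line_ex[OF L] by metis
  obtain B :: "'a^4^4" where B: "B \<in> Gq" "proj_map B P = P0"
    using P(1)
  proof (cases rule: twisted_cubic_to_P0)
    case 1
    have "mat 1 \<in> (Gq :: ('a^4^4) set)" by (metis rev_mat_mult_self Gq_mult rev_mat_Gq)
    then show ?thesis using 1 that proj_map_mat_1 by blast
  next
    case (2 s)
    then show ?thesis using that Gq_mult[OF rev_mat_Gq aff_mat_Gq] by (metis one_neq_zero)
  qed
  have "UnGamma_line (proj_map B L)" using UnGamma_line_proj_map[OF B(1) q L] .
  moreover have "P0 \<subseteq> proj_map B L"
    using proj_map_mono_iff[OF Gq_invertible[OF B(1)]] P(2) B(2) by metis
  ultimately obtain a b where ab: "a \<noteq> 0" "proj_map B L = proj_map (aff_mat 1 a b) ell0"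
    using UnGamma_line_P0_eq[OF two] by metis
  obtain C where C: "C \<in> Gq" "C ** B = mat 1" using Gq_inverse[OF B(1)] by blast
  have "L = proj_map (C ** B) L" by (simp add: C proj_map_mat_1)
  also have "\<dots> = proj_map (C ** aff_mat 1 a b) ell0" by (simp add: proj_map_mult ab)
  finally show thesis using that Gq_mult[OF C(1) aff_mat_Gq] ab(1) by (metis one_neq_zero)
qed

text \<open>\<open>A\<close> fixes \<open>P0\<close>, the only cubic point on \<open>ell0\<close>,
  so it is some \<open>aff_mat k a b\<close>. Keeping P(1,0,1,0) on \<open>ell0\<close> forces
  \<open>b = 0\<close> and \<open>a^2 = 1\<close>, hence \<open>a = 1\<close> in characteristic
  2.\<close>

lemma Gq_stabilizer_ell0:
  fixes A :: "'a::{finite,field}^4^4"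
  assumes two: "(2 :: 'a) = 0" and q: "CARD('a) > 5" and A: "A \<in> Gq"
    and fix_ell: "proj_map A ell0 = ell0"
  obtains k where "A = mat k"
proof -
  have "P0 \<in> (twisted_cubic :: ('a^4) set set) \<and> P0 \<subseteq> (ell0 :: ('a^4) set)"
    by (rule iffD2[OF twisted_cubic_ell0 refl])
  then have "proj_map A P0 \<in> twisted_cubic \<and> proj_map A P0 \<subseteq> ell0"
    using Gq_twisted_cubic[OF A] proj_map_mono_iff[OF Gq_invertible[OF A]] fix_ell by metis
  then have "proj_map A P0 = P0" by (rule iffD1[OF twisted_cubic_ell0])
  then obtain k a b where kab: "k \<noteq> 0" "a \<noteq> 0" "A = aff_mat k a b" by (rule Gq_fix_P0[OF A q])
  have "vec4 1 0 1 0 \<in> ell0" by (simp add: mem_ell0)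
  then have "A *v vec4 1 0 1 0 \<in> ell0" using fix_ell unfolding proj_map_def by blast
  then have "b = 0" "a^2 = 1^2" using kab by (auto simp: aff_mat_def mem_ell0)
  then have "A = mat k" using kab char2_square_eq_iff[OF two] aff_mat_scalar by metis
  then show thesis by (rule that)
qed

theorem theorem6p5:
  assumes "even CARD('a::{finite,field})" and "CARD('a) \<ge> 8"
  shows "{L :: ('a^4) set. UnGamma_line L} = {proj_map A ell0 | A. A \<in> Gq}
    \<and> (\<forall>L :: ('a^4) set. UnGamma_line L \<longrightarrow>
          (\<forall>A \<in> Gq. proj_map A L = L \<longrightarrow> (\<exists>c. A = mat c)))"
proof (intro conjI allI impI ballI)
  have two: "(2 :: 'a) = 0" using assms(1) by (rule even_card_field_two_eq_0)
  have q: "CARD('a) > 5" using assms(2) by simp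
  show "{L :: ('a^4) set. UnGamma_line L} = {proj_map A ell0 | A. A \<in> Gq}"
    using UnGamma_line_orbit[OF two q] UnGamma_line_proj_map[OF _ q UnGamma_line_ell0]
    by (auto; metis)
  fix L :: "('a^4) set" and A
  assume L: "UnGamma_line L" and A: "A \<in> Gq" "proj_map A L = L"
  obtain B where B: "B \<in> Gq" "L = proj_map B ell0" using UnGamma_line_orbit[OF two q L] .
  obtain C where C: "C \<in> Gq" "B ** C = mat 1" "C ** B = mat 1" using Gq_inverse[OF B(1)] .
  \<comment> \<open>Conjugation by \<open>B\<close> carries the stabiliser of \<open>L\<close> to
    that of \<open>ell0\<close>. Scalar matrices, which represent the identity projectivity, are
    central, so \<open>A\<close> is scalar as well.\<close>
  have "proj_map (C ** A ** B) ell0 = proj_map (C ** B) ell0"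
    using A(2) by (simp add: proj_map_mult B(2))
  then have "proj_map (C ** A ** B) ell0 = ell0" by (simp add: C proj_map_mat_1)
  then obtain k where k: "C ** A ** B = mat k"
    using Gq_stabilizer_ell0[OF two q] Gq_mult A(1) B(1) C(1) by metis
  have "A = (B ** C) ** A ** (B ** C)" by (simp add: C)
  also have "\<dots> = B ** (C ** A ** B) ** C" by (simp only: matrix_mul_assoc)
  also have "\<dots> = mat k"
    unfolding k matrix_eq
    by (metis C(2) mat_vec4_mult matrix_vector_mul_assoc matrix_vector_mul_lid matrix_vector_smult)
  finally show "\<exists>c. A = mat c" by blast
qed

end
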